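(* Let $n$ be a positive integer and let $a,b\in IOF_n^{par}$. Then, for the Green's relations $\mathcal{L},\mathcal{R},\mathcal{H},\mathcal{J}$ of the monoid $IOF_n^{par}$: 1) $a\,\mathcal{L}\,b$ if and only if $im(a)=im(b)$; 2) $a\,\mathcal{R}\,b$ if and only if $dom(a)=dom(b)$; 3) $a\,\mathcal{H}\,b$ if and only if $a=b$; 4) $a\,\mathcal{J}\,b$ if and only if $dom(a)\sim dom(b)$ (equivalently, if and only if $im(a)\sim im(b)$).
   Context: Let $\overline{n}=\{1<2<\cdots<n\}$, and let $I_n$ be the monoid of all partial injections $\alpha$ of $\overline{n}$ (injective maps from a subset $dom(\alpha)$ of $\overline{n}$ into $\overline{n}$, with image $im(\alpha)$). Maps are written on the right and composed left to right. The fence order $\prec$ on $\overline{n}$ is: $x\prec y$ iff $|x-y|=1$ and $x$ is odd (so $1\prec 2\succ 3\prec\cdots$). $\alpha\in I_n$ is order-preserving if $x<y$ implies $x\alpha<y\alpha$; fence-preserving if $x\prec y$ implies $x\alpha\prec y\alpha$; parity-preserving if $x$ and $x\alpha$ have the same parity (in each case for all $x,y\in dom(\alpha)$). $IOF_n^{par}$ is the monoid of all $\alpha\in I_n$ that are order-preserving and parity-preserving and such that both $\alpha$ and $\alpha^{-1}$ are fence-preserving. For nonempty subsets $\{i_1<\cdots<i_k\}$ and $\{j_1<\cdots<j_l\}$ of $\overline{n}$, write $\{i_1<\cdots<i_k\}\sim\{j_1<\cdots<j_l\}$ if $k=l$; $i_r$ and $j_r$ have the same parity for all $r\in\{1,\dots,k\}$;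 and $i_r-i_{r-1}=1$ iff $j_r-j_{r-1}=1$ for all $r\in\{2,\dots,k\}$. The empty set is $\sim$-related only to itself. *)

theory Defs
  imports "HOL-Algebra.Group"
begin

definition green_L :: "('a, 'm) monoid_scheme \<Rightarrow> 'a \<Rightarrow> 'a \<Rightarrow> bool" where
  "green_L M a b \<longleftrightarrow>
     {x \<otimes>\<^bsub>M\<^esub> a | x. x \<in> carrier M} = {x \<otimes>\<^bsub>M\<^esub> b | x. x \<in> carrier M}"

definition green_R :: "('a, 'm) monoid_scheme \<Rightarrow> 'a \<Rightarrow> 'a \<Rightarrow> bool" where
  "green_R M a b \<longleftrightarrow>
     {a \<otimes>\<^bsub>M\<^esub> x | x. x \<in> carrier M} = {b \<otimes>\<^bsub>M\<^esub> x | x. x \<in> carrier M}"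

definition green_H :: "('a, 'm) monoid_scheme \<Rightarrow> 'a \<Rightarrow> 'a \<Rightarrow> bool" where
  "green_H M a b \<longleftrightarrow> green_L M a b \<and> green_R M a b"

definition green_J :: "('a, 'm) monoid_scheme \<Rightarrow> 'a \<Rightarrow> 'a \<Rightarrow> bool" where
  "green_J M a b \<longleftrightarrow>
     {x \<otimes>\<^bsub>M\<^esub> a \<otimes>\<^bsub>M\<^esub> y | x y. x \<in> carrier M \<and> y \<in> carrier M} =
     {x \<otimes>\<^bsub>M\<^esub> b \<otimes>\<^bsub>M\<^esub> y | x y. x \<in> carrier M \<and> y \<in> carrier M}"

text \<open>
  A partial injection is a map \<open>a :: nat \<rightharpoonup> nat\<close>; its image is \<open>ran a\<close>. Maps act on the
  right, so the product of \<open>a\<close> and \<open>b\<close> applies \<open>a\<close> first, which is \<open>b \<circ>\<^sub>m a\<close>.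
\<close>

definition partial_inj :: "nat \<Rightarrow> (nat \<rightharpoonup> nat) set" where
  "partial_inj n = {a. dom a \<subseteq> {1..n} \<and> ran a \<subseteq> {1..n} \<and> inj_on a (dom a)}"

definition sym_inv_monoid :: "nat \<Rightarrow> (nat \<rightharpoonup> nat) monoid" where
  "sym_inv_monoid n =
     \<lparr>carrier = partial_inj n,
      monoid.mult = (\<lambda>a b. b \<circ>\<^sub>m a),
      one = (\<lambda>x. if x \<in> {1..n} then Some x else None)\<rparr>"

definition partial_inverse :: "(nat \<rightharpoonup> nat) \<Rightarrow> (nat \<rightharpoonup> nat)" where
  "partial_inverse a = (\<lambda>y. if y \<in> ran a then Some (THE x. a x = Some y) else None)"

definition fence_less :: "nat \<Rightarrow> nat \<Rightarrow> bool" where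
  "fence_less x y \<longleftrightarrow> \<bar>int x - int y\<bar> = 1 \<and> odd x"

definition order_preserving :: "(nat \<rightharpoonup> nat) \<Rightarrow> bool" where
  "order_preserving a \<longleftrightarrow>
     (\<forall>x\<in>dom a. \<forall>y\<in>dom a. x < y \<longrightarrow> the (a x) < the (a y))"

definition fence_preserving :: "(nat \<rightharpoonup> nat) \<Rightarrow> bool" where
  "fence_preserving a \<longleftrightarrow>
     (\<forall>x\<in>dom a. \<forall>y\<in>dom a. fence_less x y \<longrightarrow> fence_less (the (a x)) (the (a y)))"

definition parity_preserving :: "(nat \<rightharpoonup> nat) \<Rightarrow> bool" where
  "parity_preserving a \<longleftrightarrow> (\<forall>x\<in>dom a. even x \<longleftrightarrow> even (the (a x)))"

definition IOF_par :: "nat \<Rightarrow> (nat \<rightharpoonup> nat) monoid" where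
  "IOF_par n = (sym_inv_monoid n)
     \<lparr>carrier := {a \<in> partial_inj n. order_preserving a \<and> parity_preserving a \<and>
                    fence_preserving a \<and> fence_preserving (partial_inverse a)}\<rparr>"

text \<open>
  The relation \<open>\<sim>\<close>, stated on the increasing enumerations of the two sets (indexed from 0).
  Finiteness is required because \<^const>\<open>sorted_list_of_set\<close> is \<open>[]\<close> on infinite sets. The
  empty set, having the only empty enumeration, is related only to itself.
\<close>

definition fence_sim :: "nat set \<Rightarrow> nat set \<Rightarrow> bool" where
  "fence_sim A B \<longleftrightarrow> finite A \<and> finite B \<and>
     (let i = sorted_list_of_set A; j = sorted_list_of_set B in
        length i = length j \<and>
        (\<forall>r < length i. even (i ! r) \<longleftrightarrow> even (j ! r)) \<and>
        (\<forall>r. 1 \<le> r \<and> r < length i \<longrightarrow>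
           (i ! r - i ! (r - 1) = 1 \<longleftrightarrow> j ! r - j ! (r - 1) = 1)))"

lemma partial_inverse_eq_Some_iff:
  assumes "inj_on a (dom a)"
  shows "partial_inverse a y = Some x \<longleftrightarrow> a x = Some y"
proof -
  have uniq: "x = x'" if "a x = Some y" "a x' = Some y" for x x'
    using inj_onD[OF assms, of x x'] that by auto
  have "(THE x. a x = Some y) = x" if "a x = Some y" for x
    using that uniq by blast
  then show ?thesis
    by (auto simp: partial_inverse_def ran_def)
qed

lemma fence_preserving_iff:
  "fence_preserving a \<longleftrightarrow>
    (\<forall>x y x' y'. a x = Some x' \<longrightarrow> a y = Some y' \<longrightarrow> fence_less x y \<longrightarrow> fence_less x' y')"
  unfolding fence_preserving_def dom_def by force

lemma fence_preserving_partial_inverse_iff: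
  assumes "inj_on a (dom a)"
  shows "fence_preserving (partial_inverse a) \<longleftrightarrow>
    (\<forall>x\<in>dom a. \<forall>y\<in>dom a. fence_less (the (a x)) (the (a y)) \<longrightarrow> fence_less x y)"
  unfolding fence_preserving_iff partial_inverse_eq_Some_iff[OF assms] dom_def by force

lemma carrier_IOF_par:
  "a \<in> carrier (IOF_par n) \<longleftrightarrow>
     dom a \<subseteq> {1..n} \<and> ran a \<subseteq> {1..n} \<and> inj_on a (dom a) \<and>
     order_preserving a \<and> parity_preserving a \<and> fence_preserving a \<and>
     (\<forall>x\<in>dom a. \<forall>y\<in>dom a. fence_less (the (a x)) (the (a y)) \<longrightarrow> fence_less x y)"
proof (cases "inj_on a (dom a)")
  case True
  show ?thesis
    unfolding IOF_par_def partial_inj_def fence_preserving_partial_inverse_iff[OF True, symmetric]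
    by simp
qed (simp add: IOF_par_def partial_inj_def)

lemma IOF_par_simps:
  "a \<otimes>\<^bsub>IOF_par n\<^esub> b = b \<circ>\<^sub>m a"
  "\<one>\<^bsub>IOF_par n\<^esub> = (\<lambda>x. if x \<in> {1..n} then Some x else None)"
  by (simp_all add: IOF_par_def sym_inv_monoid_def)

lemma IOF_parD:
  assumes "a \<in> carrier (IOF_par n)" and "a x = Some x'"
  shows "x \<in> {1..n}" and "x' \<in> {1..n}" and "even x \<longleftrightarrow> even x'"
    and "a y = Some x' \<Longrightarrow> x = y"
    and "a y = Some y' \<Longrightarrow> x < y \<Longrightarrow> x' < y'"
    and "a y = Some y' \<Longrightarrow> fence_less x y \<longleftrightarrow> fence_less x' y'"
proof -
  have x: "x \<in> dom a" "the (a x) = x'" "x' \<in> ran a"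
    using assms(2) by (auto intro: ranI)
  note c = assms(1)[unfolded carrier_IOF_par]
  show "x \<in> {1..n}" "x' \<in> {1..n}"
    using c x by blast+
  show "even x \<longleftrightarrow> even x'"
    using c x unfolding parity_preserving_def by blast
  show "x = y" if "a y = Some x'"
    using c x that assms(2) by (intro inj_onD[of a "dom a"]) auto
  fix y' assume "a y = Some y'"
  then have y: "y \<in> dom a" "the (a y) = y'"
    by auto
  show "x < y \<Longrightarrow> x' < y'"
    using c x y unfolding order_preserving_def by blast
  show "fence_less x y \<longleftrightarrow> fence_less x' y'"
    using c x y unfolding fence_preserving_def by blast
qed

lemma IOF_parI:
  assumes "\<And>x x'. a x = Some x' \<Longrightarrow> x \<in> {1..n}" "\<And>x x'. a x = Some x' \<Longrightarrow> x' \<in> {1..n}"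
    and "\<And>x x'. a x = Some x' \<Longrightarrow> even x \<longleftrightarrow> even x'"
    and "\<And>x y x'. a x = Some x' \<Longrightarrow> a y = Some x' \<Longrightarrow> x = y"
    and "\<And>x y x' y'. a x = Some x' \<Longrightarrow> a y = Some y' \<Longrightarrow> x < y \<Longrightarrow> x' < y'"
    and "\<And>x y x' y'. a x = Some x' \<Longrightarrow> a y = Some y' \<Longrightarrow> fence_less x y \<longleftrightarrow> fence_less x' y'"
  shows "a \<in> carrier (IOF_par n)"
  unfolding carrier_IOF_par
proof (intro conjI)
  show "dom a \<subseteq> {1..n}" "ran a \<subseteq> {1..n}"
    using assms(1,2) by (blast, unfold ran_def, blast)
  show "inj_on a (dom a)"
  proof (rule inj_onI)
    fix x y assume "x \<in> dom a" "a x = a y"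
    moreover from this obtain z where "a x = Some z"
      by blast
    ultimately have "a x = Some z" "a y = Some z"
      by simp_all
    then show "x = y"
      by (rule assms(4))
  qed
  show "order_preserving a"
    unfolding order_preserving_def
  proof (intro ballI impI)
    fix x y assume "x \<in> dom a" "y \<in> dom a" "x < y"
    then show "the (a x) < the (a y)"
      by (auto intro: assms(5))
  qed
  show "parity_preserving a"
    unfolding parity_preserving_def
  proof
    fix x assume "x \<in> dom a"
    then obtain x' where "a x = Some x'"
      by blast
    then show "even x \<longleftrightarrow> even (the (a x))"
      using assms(3) by simp
  qed
  have "fence_less x y \<longleftrightarrow> fence_less (the (a x)) (the (a y))"
    if xy: "x \<in> dom a" "y \<in> dom a" for x y
  proof -
    obtain x' y' where "a x = Some x'" "a y = Some y'"
      using xy by blast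
    then show ?thesis
      using assms(6) by simp
  qed
  then show "fence_preserving a"
      "\<forall>x\<in>dom a. \<forall>y\<in>dom a. fence_less (the (a x)) (the (a y)) \<longrightarrow> fence_less x y"
    unfolding fence_preserving_def by blast+
qed

lemma IOF_par_closed:
  assumes a: "a \<in> carrier (IOF_par n)" and b: "b \<in> carrier (IOF_par n)"
  shows "b \<circ>\<^sub>m a \<in> carrier (IOF_par n)"
proof (rule IOF_parI)
  note A = IOF_parD[OF a] and B = IOF_parD[OF b]
  fix x x' assume "(b \<circ>\<^sub>m a) x = Some x'"
  then obtain u where u: "a x = Some u" "b u = Some x'"
    by (auto simp: map_comp_Some_iff)
  show "x \<in> {1..n}" by (rule A(1)[OF u(1)])
  show "x' \<in> {1..n}" by (rule B(2)[OF u(2)])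
  show "even x \<longleftrightarrow> even x'" using A(3)[OF u(1)] B(3)[OF u(2)] by simp
  {
    fix y assume "(b \<circ>\<^sub>m a) y = Some x'"
    then obtain v where v: "a y = Some v" "b v = Some x'"
      by (auto simp: map_comp_Some_iff)
    have "u = v" by (rule B(4)[OF u(2) v(2)])
    then show "x = y" using A(4)[OF u(1)] v(1) by simp
  }
  fix y y' assume "(b \<circ>\<^sub>m a) y = Some y'"
  then obtain v where v: "a y = Some v" "b v = Some y'"
    by (auto simp: map_comp_Some_iff)
  show "x' < y'" if "x < y"
    by (rule B(5)[OF u(2) v(2) A(5)[OF u(1) v(1) that]])
  show "fence_less x y \<longleftrightarrow> fence_less x' y'"
    using A(6)[OF u(1) v(1)] B(6)[OF u(2) v(2)] by simp
qed

lemma monoid_IOF_par: "monoid (IOF_par n)"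
proof (rule monoidI, unfold IOF_par_simps)
  show "b \<circ>\<^sub>m a \<in> carrier (IOF_par n)"
    if "a \<in> carrier (IOF_par n)" "b \<in> carrier (IOF_par n)" for a b
    using that by (rule IOF_par_closed)
  show "(\<lambda>x. if x \<in> {1..n} then Some x else None) \<in> carrier (IOF_par n)"
    by (rule IOF_parI) (auto split: if_splits)
  show "c \<circ>\<^sub>m (b \<circ>\<^sub>m a) = c \<circ>\<^sub>m b \<circ>\<^sub>m a" for a b c :: "nat \<rightharpoonup> nat"
    by (rule ext) (simp add: map_comp_def split: option.split)
  fix a assume a: "a \<in> carrier (IOF_par n)"
  show "a \<circ>\<^sub>m (\<lambda>x. if x \<in> {1..n} then Some x else None) = a"
  proof
    fix x
    show "(a \<circ>\<^sub>m (\<lambda>x. if x \<in> {1..n} then Some x else None)) x = a x"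
      using IOF_parD(1)[OF a, of x] by (cases "a x") (simp_all add: map_comp_def)
  qed
  show "(\<lambda>x. if x \<in> {1..n} then Some x else None) \<circ>\<^sub>m a = a"
  proof
    fix x
    show "((\<lambda>x. if x \<in> {1..n} then Some x else None) \<circ>\<^sub>m a) x = a x"
      using IOF_parD(2)[OF a, of x] by (cases "a x") (simp_all add: map_comp_def)
  qed
qed

end

theory Submission
  imports Defs
begin

text \<open>
  Every \<open>a\<close> in \<open>IOF_par n\<close> has its inverse there, so left and right divisibility are inclusion of
  images and of domains. As an order isomorphism of finite chains, \<open>a\<close> is determined by its domain
  and image, hence \<open>\<H>\<close> is trivial. Finally \<open>A \<sim> B\<close> says exactly that some \<open>c\<close> in the monoid maps
  \<open>A\<close> onto \<open>B\<close>. If \<open>a = x b y\<close> and \<open>b = x' a y'\<close>, then \<open>dom a\<close> and \<open>dom b\<close> have the same size, so \<open>x\<close>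
  restricted to \<open>dom a\<close> is such a \<open>c\<close> for \<open>dom a\<close> and \<open>dom b\<close>; conversely, such a \<open>c\<close> gives that
  \<open>c b\<close> is \<open>\<R>\<close>-related to \<open>a\<close>.
\<close>

section \<open>Green's relations as mutual divisibility in an arbitrary monoid\<close>

context monoid
begin

text \<open>Since \<open>\<one>\<close> puts each element into its own principal left ideal,
  inclusion of these ideals amounts to divisibility of the generators; equality is inclusion both
  ways. The same argument serves right and two-sided ideals.\<close>

lemma green_L_iff:
  assumes "a \<in> carrier G" "b \<in> carrier G"
  shows "green_L G a b \<longleftrightarrow> (\<exists>x\<in>carrier G. a = x \<otimes> b) \<and> (\<exists>x\<in>carrier G. b = x \<otimes> a)"
proof -
  have "{x \<otimes> c | x. x \<in> carrier G} \<subseteq> {x \<otimes> d | x. x \<in> carrier G} \<longleftrightarrow> (\<exists>x\<in>carrier G. c = x \<otimes> d)"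
    if cd: "c \<in> carrier G" "d \<in> carrier G" for c d
  proof
    have "c = \<one> \<otimes> c"
      using cd by simp
    then have "c \<in> {x \<otimes> c | x. x \<in> carrier G}"
      by blast
    then show "\<exists>x\<in>carrier G. c = x \<otimes> d"
      if "{x \<otimes> c | x. x \<in> carrier G} \<subseteq> {x \<otimes> d | x. x \<in> carrier G}"
      using that by blast
  next
    assume "\<exists>x\<in>carrier G. c = x \<otimes> d"
    then obtain u where u: "u \<in> carrier G" "c = u \<otimes> d" by blast
    have "y \<otimes> c = (y \<otimes> u) \<otimes> d" "y \<otimes> u \<in> carrier G" if "y \<in> carrier G" for y
      using that u cd by (simp_all add: m_assoc)
    then show "{x \<otimes> c | x. x \<in> carrier G} \<subseteq> {x \<otimes> d | x. x \<in> carrier G}"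
      by blast
  qed
  from this[of a b] this[of b a] show ?thesis
    unfolding green_L_def set_eq_subset using assms by simp
qed

lemma green_R_iff:
  assumes "a \<in> carrier G" "b \<in> carrier G"
  shows "green_R G a b \<longleftrightarrow> (\<exists>x\<in>carrier G. a = b \<otimes> x) \<and> (\<exists>x\<in>carrier G. b = a \<otimes> x)"
proof -
  have "{c \<otimes> x | x. x \<in> carrier G} \<subseteq> {d \<otimes> x | x. x \<in> carrier G} \<longleftrightarrow> (\<exists>x\<in>carrier G. c = d \<otimes> x)"
    if cd: "c \<in> carrier G" "d \<in> carrier G" for c d
  proof
    have "c = c \<otimes> \<one>"
      using cd by simp
    then have "c \<in> {c \<otimes> x | x. x \<in> carrier G}"
      by blast
    then show "\<exists>x\<in>carrier G. c = d \<otimes> x"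
      if "{c \<otimes> x | x. x \<in> carrier G} \<subseteq> {d \<otimes> x | x. x \<in> carrier G}"
      using that by blast
  next
    assume "\<exists>x\<in>carrier G. c = d \<otimes> x"
    then obtain u where u: "u \<in> carrier G" "c = d \<otimes> u" by blast
    have "c \<otimes> y = d \<otimes> (u \<otimes> y)" "u \<otimes> y \<in> carrier G" if "y \<in> carrier G" for y
      using that u cd by (simp_all add: m_assoc)
    then show "{c \<otimes> x | x. x \<in> carrier G} \<subseteq> {d \<otimes> x | x. x \<in> carrier G}"
      by blast
  qed
  from this[of a b] this[of b a] show ?thesis
    unfolding green_R_def set_eq_subset using assms by simp
qed

lemma green_J_iff:
  assumes "a \<in> carrier G" "b \<in> carrier G"
  shows "green_J G a b \<longleftrightarrow>
    (\<exists>x\<in>carrier G. \<exists>y\<in>carrier G. a = x \<otimes> b \<otimes> y) \<and>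
    (\<exists>x\<in>carrier G. \<exists>y\<in>carrier G. b = x \<otimes> a \<otimes> y)"
proof -
  let ?I = "\<lambda>c. {x \<otimes> c \<otimes> y | x y. x \<in> carrier G \<and> y \<in> carrier G}"
  have "?I c \<subseteq> ?I d \<longleftrightarrow> (\<exists>x\<in>carrier G. \<exists>y\<in>carrier G. c = x \<otimes> d \<otimes> y)"
    if cd: "c \<in> carrier G" "d \<in> carrier G" for c d
  proof
    have "c = \<one> \<otimes> c \<otimes> \<one>"
      using cd by simp
    then have "c \<in> ?I c"
      by blast
    then show "\<exists>x\<in>carrier G. \<exists>y\<in>carrier G. c = x \<otimes> d \<otimes> y" if "?I c \<subseteq> ?I d"
      using that by blast
  next
    assume "\<exists>x\<in>carrier G. \<exists>y\<in>carrier G. c = x \<otimes> d \<otimes> y"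
    then obtain u v where u: "u \<in> carrier G" "v \<in> carrier G" "c = u \<otimes> d \<otimes> v" by blast
    show "?I c \<subseteq> ?I d"
    proof
      fix z assume "z \<in> ?I c"
      then obtain x y where xy: "x \<in> carrier G" "y \<in> carrier G" "z = x \<otimes> c \<otimes> y"
        by blast
      have "z = (x \<otimes> u) \<otimes> d \<otimes> (v \<otimes> y)" "x \<otimes> u \<in> carrier G" "v \<otimes> y \<in> carrier G"
        using xy u cd by (simp_all add: m_assoc)
      then show "z \<in> ?I d"
        by (intro CollectI exI[of _ "x \<otimes> u"] exI[of _ "v \<otimes> y"] conjI)
    qed
  qed
  from this[of a b] this[of b a] show ?thesis
    unfolding green_J_def set_eq_subset using assms by simp
qed

end

section \<open>Successors in place of the fence; inverses and restrictions\<close>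

lemma fence_less_iff: "fence_less x y \<longleftrightarrow> odd x \<and> (y = Suc x \<or> x = Suc y)"
  unfolding fence_less_def by auto

lemma IOF_par_less_iff:
  assumes "a \<in> carrier (IOF_par n)" "a x = Some x'" "a y = Some y'"
  shows "x < y \<longleftrightarrow> x' < y'"
  using IOF_parD(5)[OF assms] IOF_parD(5)[OF assms(1,3,2)] assms(2,3)
  by (cases x y rule: linorder_cases) auto

text \<open>The fence relates two neighbours only with the odd one first. Parity selects which of
  the two fence equivalences applies, and the order tells which neighbour is the larger.\<close>

lemma IOF_par_Suc_iff:
  assumes "a \<in> carrier (IOF_par n)" "a x = Some x'" "a y = Some y'"
  shows "y = Suc x \<longleftrightarrow> y' = Suc x'"
  using IOF_par_less_iff[OF assms] IOF_parD(3)[OF assms(1,2)] IOF_parD(3)[OF assms(1,3)]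
    IOF_parD(6)[OF assms] IOF_parD(6)[OF assms(1,3,2)]
  unfolding fence_less_iff by (cases "even x") auto

text \<open>Introduction rule trading both fence conditions for one successor equivalence. Used for
  both orders of the two points, and combined with parity, that equivalence returns the fence;
  injectivity comes from strict monotonicity.\<close>

lemma IOF_par_SucI:
  assumes "dom a \<subseteq> {1..n}" "ran a \<subseteq> {1..n}"
    and parity: "\<And>x x'. a x = Some x' \<Longrightarrow> even x \<longleftrightarrow> even x'"
    and less: "\<And>x y x' y'. a x = Some x' \<Longrightarrow> a y = Some y' \<Longrightarrow> x < y \<Longrightarrow> x' < y'"
    and Suc: "\<And>x y x' y'. a x = Some x' \<Longrightarrow> a y = Some y' \<Longrightarrow> y = Suc x \<longleftrightarrow> y' = Suc x'"
  shows "a \<in> carrier (IOF_par n)"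
proof (rule IOF_parI)
  fix x x' assume x: "a x = Some x'"
  show "x \<in> {1..n}" "x' \<in> {1..n}"
    using assms(1,2) x by (blast intro: ranI)+
  show "even x \<longleftrightarrow> even x'"
    by (rule parity[OF x])
  show "x = y" if "a y = Some x'" for y
    using less[OF x that] less[OF that x] by (cases x y rule: linorder_cases) auto
  fix y y' assume y: "a y = Some y'"
  show "x < y \<Longrightarrow> x' < y'"
    by (rule less[OF x y])
  show "fence_less x y \<longleftrightarrow> fence_less x' y'"
    using Suc[OF x y] Suc[OF y x] parity[OF x] by (auto simp: fence_less_iff)
qed

lemma IOF_par_inj_on: "a \<in> carrier (IOF_par n) \<Longrightarrow> inj_on a (dom a)"
  by (simp add: carrier_IOF_par)

lemma IOF_par_finite:
  assumes "a \<in> carrier (IOF_par n)"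
  shows "finite (dom a)" "finite (ran a)"
  using assms by (auto simp: carrier_IOF_par intro: finite_subset)

lemmas IOF_par_inverse_iff = partial_inverse_eq_Some_iff[OF IOF_par_inj_on]

lemma dom_partial_inverse: "dom (partial_inverse a) = ran a"
  by (auto simp: partial_inverse_def split: if_splits)

lemma ran_partial_inverse:
  assumes "a \<in> carrier (IOF_par n)"
  shows "ran (partial_inverse a) = dom a"
  by (auto simp: ran_def dom_def IOF_par_inverse_iff[OF assms])

text \<open>The conditions on order, parity and successors are all equivalences for members of the
  monoid, so they survive exchanging arguments and values.\<close>

lemma IOF_par_inverse_closed:
  assumes "a \<in> carrier (IOF_par n)"
  shows "partial_inverse a \<in> carrier (IOF_par n)"
proof (rule IOF_par_SucI, unfold IOF_par_inverse_iff[OF assms] ran_partial_inverse[OF assms]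
    dom_partial_inverse)
  show "ran a \<subseteq> {1..n}" "dom a \<subseteq> {1..n}"
    using assms by (simp_all add: carrier_IOF_par)
next
  fix x x' assume x: "a x' = Some x"
  show "even x \<longleftrightarrow> even x'"
    using IOF_parD(3)[OF assms x] by simp
  fix y y' assume y: "a y' = Some y"
  show "x' < y'" if "x < y"
    using IOF_par_less_iff[OF assms x y] that by simp
  show "y = Suc x \<longleftrightarrow> y' = Suc x'"
    using IOF_par_Suc_iff[OF assms x y] by simp
qed

lemma IOF_par_restrict_closed:
  assumes "a \<in> carrier (IOF_par n)"
  shows "a |` A \<in> carrier (IOF_par n)"
proof (rule IOF_par_SucI)
  show "dom (a |` A) \<subseteq> {1..n}" "ran (a |` A) \<subseteq> {1..n}"
    using IOF_parD(1,2)[OF assms] by (auto simp: ran_def restrict_map_def split: if_splits)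
next
  have Some: "a x = Some x'" if "(a |` A) x = Some x'" for x x'
    using that by (simp add: restrict_map_def split: if_splits)
  fix x x' assume x: "(a |` A) x = Some x'"
  show "even x \<longleftrightarrow> even x'"
    by (rule IOF_parD(3)[OF assms Some[OF x]])
  fix y y' assume y: "(a |` A) y = Some y'"
  show "x' < y'" if "x < y"
    by (rule IOF_parD(5)[OF assms Some[OF x] Some[OF y] that])
  show "y = Suc x \<longleftrightarrow> y' = Suc x'"
    by (rule IOF_par_Suc_iff[OF assms Some[OF x] Some[OF y]])
qed

section \<open>One-sided divisibility as inclusion of images or domains\<close>

lemma dom_map_comp:
  assumes "ran a \<subseteq> dom b"
  shows "dom (b \<circ>\<^sub>m a) = dom a"
  using assms by (fastforce simp: map_comp_def ran_def dom_def split: option.splits)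

lemma IOF_par_left_dvd_iff:
  assumes a: "a \<in> carrier (IOF_par n)" and b: "b \<in> carrier (IOF_par n)"
  shows "(\<exists>x\<in>carrier (IOF_par n). a = x \<otimes>\<^bsub>IOF_par n\<^esub> b) \<longleftrightarrow> ran a \<subseteq> ran b"
proof
  show "ran a \<subseteq> ran b" if "\<exists>x\<in>carrier (IOF_par n). a = x \<otimes>\<^bsub>IOF_par n\<^esub> b"
    using that by (auto simp: IOF_par_simps ran_def map_comp_Some_iff)
next
  assume sub: "ran a \<subseteq> ran b"
  \<comment> \<open>With maps on the right, the left factor is the product of \<open>a\<close> and
    the inverse of \<open>b\<close>; it is defined on all of \<open>dom a\<close> because
    \<open>ran a\<close> lies in \<open>ran b\<close>.\<close>
  have "a x = (b \<circ>\<^sub>m (partial_inverse b \<circ>\<^sub>m a)) x" for x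
  proof (cases "a x")
    case (Some z)
    then obtain y where "b y = Some z"
      using sub by (fastforce simp: ran_def)
    with Some show ?thesis
      using IOF_par_inverse_iff[OF b, of z y] by simp
  qed simp
  then have "a = (partial_inverse b \<circ>\<^sub>m a) \<otimes>\<^bsub>IOF_par n\<^esub> b"
    by (auto simp: IOF_par_simps)
  then show "\<exists>x\<in>carrier (IOF_par n). a = x \<otimes>\<^bsub>IOF_par n\<^esub> b"
    using IOF_par_closed[OF a IOF_par_inverse_closed[OF b]] by blast
qed

lemma IOF_par_right_dvd_iff:
  assumes a: "a \<in> carrier (IOF_par n)" and b: "b \<in> carrier (IOF_par n)"
  shows "(\<exists>x\<in>carrier (IOF_par n). a = b \<otimes>\<^bsub>IOF_par n\<^esub> x) \<longleftrightarrow> dom a \<subseteq> dom b"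
proof
  show "dom a \<subseteq> dom b" if "\<exists>x\<in>carrier (IOF_par n). a = b \<otimes>\<^bsub>IOF_par n\<^esub> x"
    using that by (auto simp: IOF_par_simps map_comp_Some_iff)
next
  assume sub: "dom a \<subseteq> dom b"
  \<comment> \<open>Dually, the right factor is the inverse of \<open>b\<close> followed by
    \<open>a\<close>.\<close>
  have "a x = ((a \<circ>\<^sub>m partial_inverse b) \<circ>\<^sub>m b) x" for x
  proof (cases "b x")
    case None
    then show ?thesis
      using sub by auto
  next
    case (Some z)
    then show ?thesis
      using IOF_par_inverse_iff[OF b, of z x] by simp
  qed
  then have "a = b \<otimes>\<^bsub>IOF_par n\<^esub> (a \<circ>\<^sub>m partial_inverse b)"
    by (auto simp: IOF_par_simps)
  then show "\<exists>x\<in>carrier (IOF_par n). a = b \<otimes>\<^bsub>IOF_par n\<^esub> x"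
    using IOF_par_closed[OF IOF_par_inverse_closed[OF b] a] by blast
qed

section \<open>Increasing enumerations of domain and image\<close>

lemma sorted_list_of_ran:
  assumes a: "a \<in> carrier (IOF_par n)"
  shows "sorted_list_of_set (ran a) = map (\<lambda>x. the (a x)) (sorted_list_of_set (dom a))"
proof -
  have "strict_mono_on (dom a) (\<lambda>x. the (a x))"
    by (rule strict_mono_onI) (auto dest: IOF_parD(5)[OF a])
  then have "sorted_wrt (<) (map (\<lambda>x. the (a x)) (sorted_list_of_set (dom a)))"
    using IOF_par_finite[OF a]
    by (auto simp: sorted_wrt_map strict_mono_on_def
      intro: sorted_wrt_mono_rel[OF _ strict_sorted_list_of_set])
  moreover have "ran a = (\<lambda>x. the (a x)) ` dom a"
    by (force simp: ran_def dom_def)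
  \<comment> \<open>A strictly increasing list is determined by its set of elements.\<close>
  ultimately show ?thesis
    using IOF_par_finite[OF a]
    by (intro strict_sorted_equal) auto
qed

text \<open>Both maps send the same increasing enumeration to the same list, so they agree entry by
  entry. This is what makes \<open>green_H\<close> trivial.\<close>

lemma IOF_par_eqI:
  assumes a: "a \<in> carrier (IOF_par n)" and b: "b \<in> carrier (IOF_par n)"
    and "dom a = dom b" "ran a = ran b"
  shows "a = b"
proof
  fix x
  have "\<forall>x\<in>dom a. the (a x) = the (b x)"
    using sorted_list_of_ran[OF a] sorted_list_of_ran[OF b] assms(3,4) IOF_par_finite[OF a]
    by simp
  then show "a x = b x"
    using assms(3) by (cases "a x"; cases "b x") (force simp: dom_def)+
qed

section \<open>\<open>fence_sim\<close> as the existence of an element with given domain and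
  image\<close>

lemma fence_sim_dom_ran:
  assumes a: "a \<in> carrier (IOF_par n)"
  shows "fence_sim (dom a) (ran a)"
proof -
  let ?i = "sorted_list_of_set (dom a)"
  have Some: "a (?i ! r) = Some (the (a (?i ! r)))" if "r < length ?i" for r
    using that nth_mem[OF that] IOF_par_finite[OF a] by auto
  have diff: "?i ! r - ?i ! (r - 1) = 1 \<longleftrightarrow> the (a (?i ! r)) - the (a (?i ! (r - 1))) = 1"
    if r: "1 \<le> r" "r < length ?i" for r
  proof -
    have r': "r - 1 < length ?i"
      using r by simp
    \<comment> \<open>Although subtraction on \<open>nat\<close> truncates, a difference equal to 1
      still means exactly that the first number is the successor of the second.\<close>
    from IOF_par_Suc_iff[OF a Some[OF r'] Some[OF r(2)]] show ?thesis
      by auto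
  qed
  show ?thesis
    unfolding fence_sim_def Let_def sorted_list_of_ran[OF a]
    using IOF_par_finite[OF a] IOF_parD(3)[OF a Some] diff by (simp add: less_imp_diff_less)
qed

text \<open>An index strictly between \<open>r\<close> and \<open>s\<close> would give a value
  strictly between two consecutive naturals.\<close>

lemma strict_sorted_nth_Suc_eqD:
  fixes xs :: "nat list"
  assumes "sorted_wrt (<) xs" "r < length xs" "s < length xs" "xs ! s = Suc (xs ! r)"
  shows "s = Suc r"
proof -
  have less: "xs ! k < xs ! l \<longleftrightarrow> k < l" if "k < length xs" "l < length xs" for k l
    using sorted_wrt_nth_less[OF assms(1), of k l] sorted_wrt_nth_less[OF assms(1), of l k] that
    by (cases k l rule: linorder_cases) auto
  have "r < s"
    using less[OF assms(2,3)] assms(4) by simp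
  moreover have "\<not> Suc r < s"
    using less[of r "Suc r"] less[of "Suc r" s] assms by auto
  ultimately show ?thesis
    by simp
qed

text \<open>The element sends the \<open>r\<close>-th member of \<open>A\<close> to the
  \<open>r\<close>-th member of \<open>B\<close>. The clauses of \<open>fence_sim\<close> speak of
  neighbouring positions only, which suffices because consecutive values can occur nowhere
  else.\<close>

lemma fence_sim_obtain:
  assumes "A \<subseteq> {1..n}" "B \<subseteq> {1..n}" and sim: "fence_sim A B"
  obtains c where "c \<in> carrier (IOF_par n)" "dom c = A" "ran c = B"
proof
  define i where "i = sorted_list_of_set A"
  define j where "j = sorted_list_of_set B"
  define c where "c = map_of (zip i j)"
  \<comment> \<open>The last clause is shifted from \<open>r - 1\<close> and \<open>r\<close> to
    \<open>r\<close> and \<open>Suc r\<close>.\<close>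
  have sim': "finite A" "finite B" "length i = length j"
    "\<And>r. r < length i \<Longrightarrow> even (i ! r) \<longleftrightarrow> even (j ! r)"
    "\<And>r. Suc r < length i \<Longrightarrow> i ! Suc r - i ! r = 1 \<longleftrightarrow> j ! Suc r - j ! r = 1"
    using sim unfolding fence_sim_def Let_def i_def[symmetric] j_def[symmetric]
    by (force dest: spec[of _ "Suc _"])+
  have sorted: "sorted_wrt (<) i" "sorted_wrt (<) j" and dist: "distinct i"
    by (simp_all add: i_def j_def)
  show dom: "dom c = A"
    using sim' by (simp add: c_def dom_map_of_zip i_def)
  show ran: "ran c = B"
    using sim' dist by (simp add: c_def ran_map_of_zip j_def)
  have c: "\<exists>r<length i. x = i ! r \<and> x' = j ! r" if "c x = Some x'" for x x'
    using map_of_SomeD[OF that[unfolded c_def]] sim'(3) by (auto simp: in_set_zip)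
  have Suc_eq: "i ! s = Suc (i ! r) \<longleftrightarrow> j ! s = Suc (j ! r)"
    if rs: "r < length i" "s < length i" for r s
  proof (cases "s = Suc r")
    case True
    then show ?thesis
      using sim'(5)[of r] rs by auto
  next
    case False
    \<comment> \<open>Away from neighbouring positions both sides of the equivalence are
      false.\<close>
    then show ?thesis
      using strict_sorted_nth_Suc_eqD[OF sorted(1), of r s]
        strict_sorted_nth_Suc_eqD[OF sorted(2), of r s] rs sim'(3) by auto
  qed
  show "c \<in> carrier (IOF_par n)"
  proof (rule IOF_par_SucI)
    fix x x' assume "c x = Some x'"
    then obtain r where r: "r < length i" "x = i ! r" "x' = j ! r"
      using c by blast
    show "even x \<longleftrightarrow> even x'"
      using sim'(4) r by simp
    fix y y' assume "c y = Some y'"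
    then obtain s where s: "s < length i" "y = i ! s" "y' = j ! s"
      using c by blast
    show "y = Suc x \<longleftrightarrow> y' = Suc x'"
      using Suc_eq r s by simp
    show "x' < y'" if "x < y"
    proof -
      have "r < s"
        using that r s sorted_wrt_nth_less[OF sorted(1), of s r]
        by (cases r s rule: linorder_cases) auto
      then show ?thesis
        using r s sorted_wrt_nth_less[OF sorted(2)] sim'(3) by simp
    qed
  qed (use dom ran assms in simp_all)
qed

section \<open>Two-sided divisibility and \<open>fence_sim\<close>\<close>

lemma fence_sim_sym: "fence_sim A B \<Longrightarrow> fence_sim B A"
  by (auto simp: fence_sim_def Let_def)

lemma fence_sim_trans: "fence_sim A B \<Longrightarrow> fence_sim B C \<Longrightarrow> fence_sim A C"
  by (auto simp: fence_sim_def Let_def)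

lemma IOF_par_dvd_if_fence_sim:
  assumes a: "a \<in> carrier (IOF_par n)" and b: "b \<in> carrier (IOF_par n)"
    and sim: "fence_sim (dom a) (dom b)"
  shows "\<exists>x\<in>carrier (IOF_par n). \<exists>y\<in>carrier (IOF_par n).
    a = x \<otimes>\<^bsub>IOF_par n\<^esub> b \<otimes>\<^bsub>IOF_par n\<^esub> y"
proof -
  obtain c where c: "c \<in> carrier (IOF_par n)" "dom c = dom a" "ran c = dom b"
    using fence_sim_obtain[OF _ _ sim] a b unfolding carrier_IOF_par by metis
  \<comment> \<open>Since \<open>c\<close> maps onto \<open>dom b\<close>, no point is lost when
    \<open>b\<close> follows; so \<open>a\<close> is a right multiple of the product of
    \<open>c\<close> and \<open>b\<close>, and \<open>c\<close> serves as the left factor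
    \<open>x\<close>.\<close>
  have "dom a \<subseteq> dom (b \<circ>\<^sub>m c)"
    using c dom_map_comp[of c b] by simp
  then show ?thesis
    using IOF_par_right_dvd_iff[OF a IOF_par_closed[OF c(1) b]] c(1)
    by (auto simp: IOF_par_simps)
qed

text \<open>Wherever \<open>a\<close> is defined, \<open>x\<close> must be defined with value in
  \<open>dom b\<close>. Thus \<open>x\<close> embeds \<open>dom a\<close> into \<open>dom b\<close>,
  and equal lengths of the enumerations give equal cardinalities.\<close>

lemma IOF_par_dvd_dom_image:
  assumes x: "x \<in> carrier (IOF_par n)" and b: "b \<in> carrier (IOF_par n)"
    and eq: "a = x \<otimes>\<^bsub>IOF_par n\<^esub> b \<otimes>\<^bsub>IOF_par n\<^esub> y"
  shows "dom (x |` dom a) = dom a" "ran (x |` dom a) \<subseteq> dom b" "card (dom a) = card (ran (x |` dom a))"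
proof -
  have *: "\<exists>u v. x z = Some u \<and> b u = Some v" if "z \<in> dom a" for z
    using that by (auto simp: eq IOF_par_simps map_comp_Some_iff)
  then show dom: "dom (x |` dom a) = dom a"
    by force
  show "ran (x |` dom a) \<subseteq> dom b"
    using * by (fastforce simp: ran_def restrict_map_def split: if_splits)
  let ?c = "x |` dom a"
  have c: "?c \<in> carrier (IOF_par n)"
    by (rule IOF_par_restrict_closed[OF x])
  show "card (dom a) = card (ran ?c)"
    using arg_cong[OF sorted_list_of_ran[OF c], of length] IOF_par_finite[OF c] dom by simp
qed

lemma fence_sim_if_IOF_par_dvd:
  assumes a: "a \<in> carrier (IOF_par n)" and b: "b \<in> carrier (IOF_par n)"
    and x: "x \<in> carrier (IOF_par n)" "a = x \<otimes>\<^bsub>IOF_par n\<^esub> b \<otimes>\<^bsub>IOF_par n\<^esub> y"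
    and x': "x' \<in> carrier (IOF_par n)" "b = x' \<otimes>\<^bsub>IOF_par n\<^esub> a \<otimes>\<^bsub>IOF_par n\<^esub> y'"
  shows "fence_sim (dom a) (dom b)"
proof -
  note xa = IOF_par_dvd_dom_image[OF x(1) b x(2)]
  note xb = IOF_par_dvd_dom_image[OF x'(1) a x'(2)]
  \<comment> \<open>\<open>x'\<close> embeds \<open>dom b\<close> into \<open>dom a\<close>, and
    \<open>x\<close> preserves the size of \<open>dom a\<close>; by finiteness the image under
    \<open>x\<close> then fills \<open>dom b\<close>.\<close>
  have "card (dom b) \<le> card (ran (x |` dom a))"
    using xa(3) xb(3) card_mono[OF IOF_par_finite(1)[OF a] xb(2)] by simp
  then have "ran (x |` dom a) = dom b"
    using card_seteq[OF IOF_par_finite(1)[OF b] xa(2)] by simp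
  then show ?thesis
    using fence_sim_dom_ran[OF IOF_par_restrict_closed[OF x(1), of "dom a"]] xa(1) by simp
qed

theorem proposition2:
  fixes n :: nat and a b :: "nat \<rightharpoonup> nat"
  assumes "n > 0"
    and "a \<in> carrier (IOF_par n)" and "b \<in> carrier (IOF_par n)"
  shows "(green_L (IOF_par n) a b \<longleftrightarrow> ran a = ran b) \<and>
    (green_R (IOF_par n) a b \<longleftrightarrow> dom a = dom b) \<and>
    (green_H (IOF_par n) a b \<longleftrightarrow> a = b) \<and>
    (green_J (IOF_par n) a b \<longleftrightarrow> fence_sim (dom a) (dom b)) \<and>
    (green_J (IOF_par n) a b \<longleftrightarrow> fence_sim (ran a) (ran b))"
proof -
  interpret M: monoid "IOF_par n"
    by (rule monoid_IOF_par)
  note ab = assms(2,3)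
  have L: "green_L (IOF_par n) a b \<longleftrightarrow> ran a = ran b"
    unfolding M.green_L_iff[OF ab] IOF_par_left_dvd_iff[OF ab] IOF_par_left_dvd_iff[OF ab(2,1)]
    by auto
  have R: "green_R (IOF_par n) a b \<longleftrightarrow> dom a = dom b"
    unfolding M.green_R_iff[OF ab] IOF_par_right_dvd_iff[OF ab] IOF_par_right_dvd_iff[OF ab(2,1)]
    by auto
  have H: "green_H (IOF_par n) a b \<longleftrightarrow> a = b"
    unfolding green_H_def L R using IOF_par_eqI[OF ab] by auto
  have J: "green_J (IOF_par n) a b \<longleftrightarrow> fence_sim (dom a) (dom b)"
    unfolding M.green_J_iff[OF ab]
    using fence_sim_if_IOF_par_dvd[OF ab] IOF_par_dvd_if_fence_sim[OF ab]
      IOF_par_dvd_if_fence_sim[OF ab(2,1)] fence_sim_sym by blast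
  \<comment> \<open>Each of \<open>a\<close> and \<open>b\<close> itself links its domain to its
    image.\<close>
  have "fence_sim (dom a) (dom b) \<longleftrightarrow> fence_sim (ran a) (ran b)"
    using fence_sim_dom_ran[OF ab(1)] fence_sim_dom_ran[OF ab(2)] fence_sim_sym fence_sim_trans
    by blast
  with L R H J show ?thesis
    by simp
qed

end
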